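(* Let $G=(V,E)$ be an orientation of a finite connected graph and let $p\geq2$ be an integer. Then the normal form of the flow polynomial of $G$ is $$[f_G^p]=p\cdot\sum_{\psi:E\to\{0,\dots,p-2\}}c(\psi)\prod_{e\in E}x_e^{\psi(e)},$$ where $c(\psi)$ denotes the number of even $\psi$-conformal dual $p$-flows on $G$ minus the number of odd $\psi$-conformal dual $p$-flows on $G$.
   Context: $\mathbb{Z}_p=\{0,\dots,p-1\}$ is the integers modulo $p$. $\delta^-(v)$ ($\delta^+(v)$) is the set of arcs with head (tail) $v$. The flow polynomial is $f_G^p:=\prod_{v\in V}\sum_{i=0}^{p-1}\Big(\prod_{e\in\delta^-(v)}x_e\prod_{e\in\delta^+(v)}x_e^{p-1}\Big)^i\in\mathbb{C}[x_e:e\in E]$. Let $I_E^p:=\mathrm{ideal}\{\sum_{i=0}^{p-1}x_e^i:e\in E\}$. Basic monomials are $\prod_{e}x_e^{\psi(e)}$ with $\psi:E\to\{0,\dots,p-2\}$; their classes form a $\mathbb{C}$-basis of $\mathbb{C}[x]/I_E^p$, and the normal form $[f]$ of $f$ is the unique $\mathbb{C}$-linear combination of basic monomials with $f-[f]\in I_E^p$. A dual $p$-flow is a map $\phi:E\to\mathbb{Z}_p$ such that for every circuit of the underlying graph, traversed in one direction, the signed sum of $\phi$ over its arcs ($+$ for arcs traversed forward, $-$ for arcs traversed backward) is $0$ in $\mathbb{Z}_p$. A map $\phi:E\to\mathbb{Z}_p$ is even if $|\phi^{-1}(p-1)|$ is even and odd otherwise. For $\psi:E\to\{0,\dots,p-2\}$,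 $\phi$ is $\psi$-conformal if $\phi(e)\in\{\psi(e),p-1\}$ for all $e$. *)

theory Defs
  imports
    Complex_Main
    "HOL-Library.Poly_Mapping"
    "HOL-Library.FuncSet"
    "HOL-Number_Theory.Cong"
    "Graph_Theory.Digraph_Component"
begin

text \<open>
  A polynomial over the complex numbers is a finitely supported map from exponent vectors
  to coefficients.  The index type of the variables may be larger than the arc set \<open>E\<close>
  (which may even be empty), so the ring of polynomials in the \<open>x\<^sub>e\<close> with \<open>e \<in> E\<close>
  is carved out as \<open>polys_in E\<close>.
\<close>

type_synonym 'e cpoly = "('e \<Rightarrow>\<^sub>0 nat) \<Rightarrow>\<^sub>0 complex"

definition pvar :: "'e \<Rightarrow> 'e cpoly" where
  "pvar e = Poly_Mapping.single (Poly_Mapping.single e 1) 1"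

definition pconst :: "complex \<Rightarrow> 'e cpoly" where
  "pconst c = Poly_Mapping.single 0 c"

definition polys_in :: "'e set \<Rightarrow> 'e cpoly set" where
  "polys_in E = {f. \<forall>m\<in>Poly_Mapping.keys f. Poly_Mapping.keys m \<subseteq> E}"

definition root_ideal :: "nat \<Rightarrow> 'e set \<Rightarrow> 'e cpoly set" where
  "root_ideal p E =
     {(\<Sum>e\<in>E. q e * (\<Sum>i=0..p-1. pvar e ^ i)) | q. \<forall>e\<in>E. q e \<in> polys_in E}"

definition basic_exponents :: "nat \<Rightarrow> 'e set \<Rightarrow> ('e \<Rightarrow> nat) set" where
  "basic_exponents p E = (E \<rightarrow>\<^sub>E {0..p-2})"

definition power_product :: "'e set \<Rightarrow> ('e \<Rightarrow> nat) \<Rightarrow> 'e cpoly" where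
  "power_product E \<psi> = (\<Prod>e\<in>E. pvar e ^ \<psi> e)"

definition basic_combinations :: "nat \<Rightarrow> 'e set \<Rightarrow> 'e cpoly set" where
  "basic_combinations p E =
     {(\<Sum>\<psi>\<in>basic_exponents p E. pconst (a \<psi>) * power_product E \<psi>) | a. True}"

definition normal_form :: "nat \<Rightarrow> 'e set \<Rightarrow> 'e cpoly \<Rightarrow> 'e cpoly" where
  "normal_form p E f = (THE g. g \<in> basic_combinations p E \<and> f - g \<in> root_ideal p E)"

definition flow_poly :: "nat \<Rightarrow> ('v, 'e) pre_digraph \<Rightarrow> 'e cpoly" where
  "flow_poly p G =
     (\<Prod>v\<in>verts G. \<Sum>i=0..p-1.
        ((\<Prod>e\<in>in_arcs G v. pvar e) * (\<Prod>e\<in>out_arcs G v. pvar e ^ (p - 1))) ^ i)"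

text \<open>
  Each arc \<open>e\<close> of \<open>G\<close> yields two arcs of \<open>two_way G\<close>: \<open>(e, True)\<close> is \<open>e\<close> traversed
  forward, \<open>(e, False)\<close> is \<open>e\<close> traversed backward.  A circuit of the underlying graph
  together with a direction of traversal is a cycle of \<open>two_way G\<close> using no arc of \<open>G\<close>
  twice.  Loops are circuits of length one, pairs of parallel or antiparallel arcs are
  circuits of length two.
\<close>

definition two_way :: "('v, 'e) pre_digraph \<Rightarrow> ('v, 'e \<times> bool) pre_digraph" where
  "two_way G =
     \<lparr>verts = verts G,
      arcs = arcs G \<times> UNIV,
      tail = (\<lambda>(e, fwd). if fwd then tail G e else head G e),
      head = (\<lambda>(e, fwd). if fwd then head G e else tail G e)\<rparr>"

definition traversed_circuit :: "('v, 'e) pre_digraph \<Rightarrow> ('e \<times> bool) list \<Rightarrow> bool" where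
  "traversed_circuit G c \<longleftrightarrow> pre_digraph.cycle (two_way G) c \<and> distinct (map fst c)"

definition dual_flow :: "nat \<Rightarrow> ('v, 'e) pre_digraph \<Rightarrow> ('e \<Rightarrow> nat) \<Rightarrow> bool" where
  "dual_flow p G \<phi> \<longleftrightarrow>
     \<phi> \<in> arcs G \<rightarrow>\<^sub>E {0..p-1} \<and>
     (\<forall>c. traversed_circuit G c \<longrightarrow>
        [(\<Sum>(e, fwd)\<leftarrow>c. if fwd then int (\<phi> e) else - int (\<phi> e)) = 0] (mod int p))"

definition even_map :: "nat \<Rightarrow> 'e set \<Rightarrow> ('e \<Rightarrow> nat) \<Rightarrow> bool" where
  "even_map p E \<phi> \<longleftrightarrow> even (card {e \<in> E. \<phi> e = p - 1})"

definition conformal :: "nat \<Rightarrow> 'e set \<Rightarrow> ('e \<Rightarrow> nat) \<Rightarrow> ('e \<Rightarrow> nat) \<Rightarrow> bool" where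
  "conformal p E \<psi> \<phi> \<longleftrightarrow> (\<forall>e\<in>E. \<phi> e \<in> {\<psi> e, p - 1})"

definition conformal_excess :: "nat \<Rightarrow> ('v, 'e) pre_digraph \<Rightarrow> ('e \<Rightarrow> nat) \<Rightarrow> int" where
  "conformal_excess p G \<psi> =
     int (card {\<phi>. dual_flow p G \<phi> \<and> conformal p (arcs G) \<psi> \<phi> \<and> even_map p (arcs G) \<phi>}) -
     int (card {\<phi>. dual_flow p G \<phi> \<and> conformal p (arcs G) \<psi> \<phi> \<and> \<not> even_map p (arcs G) \<phi>})"

end

theory Submission
  imports Defs
begin

text \<open>
  Expanding the product over the vertices writes the flow polynomial as a sum over all vertex
  potentials \<open>y\<close>, in which \<open>x\<^sub>e\<close> has exponent \<open>y (head e) + (p - 1) * y (tail e)\<close>.  Modulo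
  the ideal \<open>x\<^sub>e ^ p \<equiv> 1\<close>, so this exponent may be replaced by the coboundary of \<open>y\<close>.
  Coboundaries are exactly the dual flows, and as \<open>G\<close> is connected each of them comes from
  \<open>p\<close> potentials.  Replacing \<open>x\<^sub>e ^ (p - 1)\<close> by \<open>- (1 + \<dots> + x\<^sub>e ^ (p - 2))\<close> spreads each dual
  flow, with the sign given by its parity, over the basic monomials to which it is conformal.
  Linear independence of the basic monomials modulo the ideal is seen from explicit
  coefficient functionals that annihilate the ideal.
\<close>

section \<open>Potentials and dual flows\<close>

definition walk_sum :: "('e \<Rightarrow> nat) \<Rightarrow> ('e \<times> bool) list \<Rightarrow> int" where
  "walk_sum \<phi> c = (\<Sum>(e, fwd)\<leftarrow>c. if fwd then int (\<phi> e) else - int (\<phi> e))"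

lemma walk_sum_Nil [simp]: "walk_sum \<phi> [] = 0"
  and walk_sum_Cons [simp]:
    "walk_sum \<phi> ((e, b) # c) = (if b then int (\<phi> e) else - int (\<phi> e)) + walk_sum \<phi> c"
  and walk_sum_append [simp]: "walk_sum \<phi> (c @ d) = walk_sum \<phi> c + walk_sum \<phi> d"
  by (simp_all add: walk_sum_def)

definition reverse_walk :: "('e \<times> bool) list \<Rightarrow> ('e \<times> bool) list" where
  "reverse_walk c = rev (map (\<lambda>(e, b). (e, \<not> b)) c)"

lemma walk_sum_reverse: "walk_sum \<phi> (reverse_walk c) = - walk_sum \<phi> c"
  by (induction c) (auto simp: reverse_walk_def)

lemma two_way_simps [simp]:
  "verts (two_way G) = verts G"
  "arcs (two_way G) = arcs G \<times> UNIV"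
  "tail (two_way G) (e, b) = (if b then tail G e else head G e)"
  "head (two_way G) (e, b) = (if b then head G e else tail G e)"
  by (simp_all add: two_way_def)

lemma (in wf_digraph) wf_two_way: "wf_digraph (two_way G)"
  by unfold_locales (auto split: if_splits)

text \<open>With the junction existential, a walk can be cut at several places without computing its
  intermediate vertices.\<close>

lemma (in wf_digraph) awalk_append_ex:
  "awalk u (p @ q) v \<longleftrightarrow> (\<exists>w. awalk u p w \<and> awalk w q v)"
  by (metis awalk_append_iff awalk_appendI)

lemma (in wf_digraph) awalk_reverse:
  assumes "pre_digraph.awalk (two_way G) u c v"
  shows "pre_digraph.awalk (two_way G) v (reverse_walk c) u"
proof -
  interpret T: wf_digraph "two_way G" by (rule wf_two_way)
  show ?thesis
    using assms
  proof (induction c arbitrary: u)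
    case Nil
    then show ?case by (auto simp: T.awalk_Nil_iff reverse_walk_def)
  next
    case (Cons a c)
    obtain e b where a: "a = (e, b)" by fastforce
    have "T.awalk v (reverse_walk c) (head (two_way G) (e, b))"
      using Cons by (simp add: T.awalk_Cons_iff a)
    moreover have "T.awalk (head (two_way G) (e, b)) [(e, \<not> b)] u"
      using Cons.prems by (auto simp: T.awalk_Cons_iff T.awalk_Nil_iff a)
    ultimately show ?case
      unfolding a reverse_walk_def by (auto intro: T.awalk_appendI simp del: T.awalk_append_iff)
  qed
qed

text \<open>The repetition is among the images, so \<open>x\<close> and \<open>y\<close> may differ:
  with \<open>head\<close> it marks a revisited vertex, with \<open>fst\<close> an arc used twice,
  possibly in opposite directions.\<close>

lemma not_distinct_map_decomp:
  assumes "\<not> distinct (map f xs)"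
  obtains as x bs y cs where "xs = as @ [x] @ bs @ [y] @ cs" and "f x = f y"
proof -
  have "\<exists>as x bs y cs. xs = as @ [x] @ bs @ [y] @ cs \<and> f x = f y"
    using assms
  proof (induction xs)
    case (Cons z zs)
    show ?case
    proof (cases "distinct (map f zs)")
      case True
      with Cons.prems obtain y where "y \<in> set zs" "f z = f y" by auto
      then show ?thesis by (metis append_Cons append_Nil split_list)
    next
      case False
      with Cons.IH show ?thesis by (metis append_Cons)
    qed
  qed simp
  with that show thesis by blast
qed

text \<open>
  A closed walk that is no circuit revisits a vertex, or passes an arc in both directions;
  either way it splits into shorter closed walks.
\<close>
lemma (in wf_digraph) dual_flow_closed_walk:
  assumes "dual_flow p G \<phi>" and "pre_digraph.awalk (two_way G) u c u"
  shows "[walk_sum \<phi> c = 0] (mod int p)"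
proof -
  interpret T: wf_digraph "two_way G" by (rule wf_two_way)
  show ?thesis
    using assms(2)
  proof (induction "length c" arbitrary: u c rule: less_induct)
    case less
    \<comment> \<open>For a nonempty closed walk, being a cycle means that
      \<open>tl (awalk_verts u c)\<close> is distinct, and that list consists of the heads of the
      arcs of \<open>c\<close>.\<close>
    consider (Nil) "c = []" | (circuit) "traversed_circuit G c"
      | (vertex) "\<not> distinct (map (head (two_way G)) c)"
      | (arc) "distinct (map (head (two_way G)) c)" "\<not> distinct (map fst c)"
      using less.prems T.awalk_verts_conv'[of u c u]
      unfolding traversed_circuit_def T.cycle_def by (force simp: T.awalk_def)
    then show ?case
    proof cases
      case Nil
      then show ?thesis by simp
    next
      case circuit
      then show ?thesis using assms(1) by (simp add: dual_flow_def walk_sum_def)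
    next
      case vertex
      \<comment> \<open>The brackets cut the walk right after \<open>a\<close> and right after
        \<open>b\<close>, both times at \<open>y\<close>: \<open>c2 @ [b]\<close> is a closed
        excursion, and skipping it leaves a closed walk.\<close>
      then obtain c1 a c2 b c3 y where c: "c = (c1 @ [a]) @ (c2 @ [b]) @ c3"
        and ab: "head (two_way G) a = y" "head (two_way G) b = y"
        by (rule not_distinct_map_decomp) auto
      from less.prems have "T.awalk u (c1 @ [a]) y" "T.awalk y (c2 @ [b]) y" "T.awalk y c3 u"
        unfolding c T.awalk_append_ex by (auto simp: T.awalk_simps ab)
      then have "T.awalk u ((c1 @ [a]) @ c3) u" "T.awalk y (c2 @ [b]) y"
        by (blast intro: T.awalk_appendI)+
      then have "[walk_sum \<phi> ((c1 @ [a]) @ c3) = 0] (mod int p)"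
        "[walk_sum \<phi> (c2 @ [b]) = 0] (mod int p)"
        by (intro less.hyps; simp add: c)+
      from cong_add[OF this] show ?thesis by (cases a; cases b) (simp add: c add_ac)
    next
      case arc
      obtain c1 e b c2 b' c3 where c: "c = c1 @ [(e, b)] @ c2 @ [(e, b')] @ c3"
        using arc(2) by (rule not_distinct_map_decomp) auto
      \<comment> \<open>Equal directions would repeat the head of \<open>(e, b)\<close>.\<close>
      have b': "b' = (\<not> b)" using arc(1) unfolding c by auto
      \<comment> \<open>The arc \<open>e\<close> leads from \<open>x\<close> to \<open>y\<close> and
        later back. Dropping both passages leaves two closed walks, and the contributions of
        \<open>e\<close> cancel.\<close>
      from less.prems obtain x y where "T.awalk u c1 x" "T.awalk y c2 y" "T.awalk x c3 u"
        unfolding c T.awalk_append_ex by (auto simp: T.awalk_simps b' split: if_splits)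
      then have "T.awalk u (c1 @ c3) u" "T.awalk y c2 y"
        by (blast intro: T.awalk_appendI)+
      then have "[walk_sum \<phi> (c1 @ c3) = 0] (mod int p)" "[walk_sum \<phi> c2 = 0] (mod int p)"
        by (intro less.hyps; simp add: c)+
      from cong_add[OF this] show ?thesis by (simp add: c b' add_ac)
    qed
  qed
qed

text \<open>Connectedness is strong connectedness of \<open>mk_symmetric G\<close>, whose arcs are
  mere vertex pairs. Each pair on a path there lifts to some arc of \<open>G\<close>, passed forward
  or backward.\<close>

lemma (in wf_digraph) connected_two_way_awalk:
  assumes "Digraph_Component.connected G" and "u \<in> verts G" and "v \<in> verts G"
  obtains c where "pre_digraph.awalk (two_way G) u c v"
proof -
  interpret T: wf_digraph "two_way G" by (rule wf_two_way)
  interpret S: pair_wf_digraph "mk_symmetric G" by (rule wellformed_mk_symmetric)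
  have "u \<rightarrow>\<^sup>*\<^bsub>mk_symmetric G\<^esub> v"
    using assms by (auto simp: connected_def strongly_connected_def)
  then have "\<exists>c. T.awalk u c v"
  proof (induction rule: S.reachable_induct)
    case base
    then show ?case by (auto intro: exI[of _ "[]"] simp: T.awalk_Nil_iff)
  next
    case (step x y)
    then obtain c where c: "T.awalk u c x" by blast
    from step(2) obtain e where "e \<in> arcs G"
      and "(x, y) = (tail G e, head G e) \<or> (x, y) = (head G e, tail G e)"
      by (auto simp: parcs_mk_symmetric)
    then have "T.awalk x [(e, x = tail G e)] y \<or> T.awalk x [(e, False)] y"
      by (auto simp: T.awalk_simps)
    with c show ?case by (blast intro: T.awalk_appendI)
  qed
  with that show ?thesis by blast
qed

text \<open>The factor \<open>p - 1\<close> stands for \<open>-1\<close>, which the natural numbers lack.\<close>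
definition coboundary :: "nat \<Rightarrow> ('v, 'e) pre_digraph \<Rightarrow> ('v \<Rightarrow> nat) \<Rightarrow> 'e \<Rightarrow> nat" where
  "coboundary p G y = (\<lambda>e\<in>arcs G. (y (head G e) + (p - 1) * y (tail G e)) mod p)"

lemma coboundary_cong:
  assumes "p > 0" and "e \<in> arcs G"
  shows "[int (coboundary p G y e) = int (y (head G e)) - int (y (tail G e))] (mod int p)"
proof -
  have "[int (coboundary p G y e) = int (y (head G e)) + (int p - 1) * int (y (tail G e))] (mod int p)"
    using assms by (simp add: coboundary_def zmod_int of_nat_diff)
  also have "int (y (head G e)) + (int p - 1) * int (y (tail G e)) =
      (int (y (head G e)) - int (y (tail G e))) + int p * int (y (tail G e))"
    by (simp add: algebra_simps)
  also have "[\<dots> = int (y (head G e)) - int (y (tail G e))] (mod int p)"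
    by (simp add: cong_def)
  finally show ?thesis .
qed

lemma coboundary_eqI:
  assumes "p > 0" and "\<phi> \<in> arcs G \<rightarrow>\<^sub>E {0..p-1}"
    and "\<And>e. e \<in> arcs G \<Longrightarrow> [int (\<phi> e) = int (y (head G e)) - int (y (tail G e))] (mod int p)"
  shows "coboundary p G y = \<phi>"
proof
  fix e
  show "coboundary p G y e = \<phi> e"
  proof (cases "e \<in> arcs G")
    case True
    have "[int (coboundary p G y e) = int (\<phi> e)] (mod int p)"
      using coboundary_cong[OF assms(1) True] assms(3)[OF True] by (metis cong_sym cong_trans)
    then have "[coboundary p G y e = \<phi> e] (mod p)" by (simp add: cong_int_iff)
    moreover have "\<phi> e \<in> {0..p-1}" using assms(2) True by blast
    then have "\<phi> e < p" using assms(1) by auto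
    moreover have "coboundary p G y e < p" using True assms(1) by (simp add: coboundary_def)
    ultimately show ?thesis by (simp add: cong_def)
  next
    case False
    \<comment> \<open>Off the arcs both functions are extensional, with value
      \<open>undefined\<close>.\<close>
    then show ?thesis using assms(2) by (auto simp: coboundary_def)
  qed
qed

text \<open>The differences of \<open>y\<close> telescope along the walk, a backward arc
  contributing the negated difference.\<close>

lemma (in wf_digraph) walk_sum_coboundary:
  assumes "p > 0" and "pre_digraph.awalk (two_way G) u c v"
  shows "[walk_sum (coboundary p G y) c = int (y v) - int (y u)] (mod int p)"
proof -
  interpret T: wf_digraph "two_way G" by (rule wf_two_way)
  show ?thesis
    using assms(2)
  proof (induction c arbitrary: u)
    case Nil
    then show ?case by (simp add: T.awalk_Nil_iff)
  next
    case (Cons a c)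
    obtain e b where a: "a = (e, b)" by fastforce
    let ?w = "head (two_way G) (e, b)"
    have e: "e \<in> arcs G" and u: "u = tail (two_way G) (e, b)"
      and IH: "[walk_sum (coboundary p G y) c = int (y v) - int (y ?w)] (mod int p)"
      using Cons by (auto simp: T.awalk_Cons_iff a)
    have "[(if b then int (coboundary p G y e) else - int (coboundary p G y e)) =
        int (y ?w) - int (y u)] (mod int p)"
      using coboundary_cong[OF assms(1) e, of y]
        cong_minus_minus_iff[of "int (coboundary p G y e)" "int (y (head G e)) - int (y (tail G e))" "int p"]
      by (auto simp: u)
    from cong_add[OF this IH] show ?case by (simp add: a)
  qed
qed

lemma (in wf_digraph) dual_flow_coboundary:
  assumes "p > 0"
  shows "dual_flow p G (coboundary p G y)"
proof -
  have "coboundary p G y e \<le> p - 1" if "e \<in> arcs G" for e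
    using that assms mod_less_divisor[of p] by (simp add: coboundary_def less_Suc_eq_le[symmetric])
  then have "coboundary p G y \<in> arcs G \<rightarrow>\<^sub>E {0..p-1}"
    by (auto simp: coboundary_def)
  moreover have "[walk_sum (coboundary p G y) c = 0] (mod int p)" if "traversed_circuit G c" for c
    using that walk_sum_coboundary[OF assms]
    unfolding traversed_circuit_def pre_digraph.cycle_def by fastforce
  ultimately show ?thesis by (simp add: dual_flow_def walk_sum_def)
qed

text \<open>Integrating \<open>\<phi>\<close> along walks from a root \<open>r\<close> recovers a
  potential from its value at \<open>r\<close>, and this value can be chosen freely in
  \<open>p\<close> ways. In particular every dual flow is a coboundary.\<close>

lemma (in wf_digraph) card_coboundary_fiber:
  assumes conn: "Digraph_Component.connected G" and p: "p > 0" and \<phi>: "dual_flow p G \<phi>"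
  shows "card {y \<in> verts G \<rightarrow>\<^sub>E {0..p-1}. coboundary p G y = \<phi>} = p"
proof -
  interpret T: wf_digraph "two_way G" by (rule wf_two_way)
  obtain r where r: "r \<in> verts G"
    using conn by (auto simp: connected_def strongly_connected_def)
  have "\<forall>v\<in>verts G. \<exists>c. T.awalk r c v"
    using connected_two_way_awalk[OF conn r] by metis
  then obtain c where c: "\<And>v. v \<in> verts G \<Longrightarrow> T.awalk r (c v) v" by metis
  \<comment> \<open>The potential with value \<open>k\<close> at \<open>r\<close>, reduced mod
    \<open>p\<close>. The choice of the walks \<open>c v\<close> is immaterial because closed walks
    have sum zero.\<close>
  define Y where "Y k = (\<lambda>v\<in>verts G. nat ((int k + walk_sum \<phi> (c v)) mod int p))" for k
  have Y: "[int (Y k v) = int k + walk_sum \<phi> (c v)] (mod int p)" if "v \<in> verts G" for k v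
    using that p by (simp add: Y_def)
  have Y_range: "Y k \<in> verts G \<rightarrow>\<^sub>E {0..p-1}" for k
  proof -
    have "nat (x mod int p) \<le> p - 1" for x
      using p pos_mod_bound[of "int p" x] by linarith
    then show ?thesis by (auto simp: Y_def)
  qed
  have Yr: "Y k r = k" if "k < p" for k
  proof -
    \<comment> \<open>The walk \<open>c r\<close> need not be empty, but it is closed.\<close>
    have "[int k + walk_sum \<phi> (c r) = int k + 0] (mod int p)"
      by (intro cong_add cong_refl dual_flow_closed_walk[OF \<phi> c[OF r]])
    then have "[int (Y k r) = int k] (mod int p)"
      using Y[OF r, of k] by (metis add.right_neutral cong_trans)
    moreover have "Y k r < p" using Y_range[of k] r p by (auto dest!: PiE_mem)
    ultimately show ?thesis using that by (simp add: cong_int_iff cong_def)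
  qed
  have "{y \<in> verts G \<rightarrow>\<^sub>E {0..p-1}. coboundary p G y = \<phi>} = Y ` {..<p}"
  proof (intro equalityI subsetI)
    fix y assume "y \<in> {y \<in> verts G \<rightarrow>\<^sub>E {0..p-1}. coboundary p G y = \<phi>}"
    then have y: "y \<in> verts G \<rightarrow>\<^sub>E {0..p-1}" and cob: "coboundary p G y = \<phi>" by auto
    have lt: "y v < p" "Y k v < p" if "v \<in> verts G" for v k
      using PiE_mem[OF y that] PiE_mem[OF Y_range that, of k] p by auto
    have "y v = Y (y r) v" if v: "v \<in> verts G" for v
    proof -
      \<comment> \<open>Since \<open>\<phi>\<close> is the coboundary of \<open>y\<close>,
        telescoping along \<open>c v\<close> forces the value at \<open>v\<close>.\<close>
      have "[int (y r) + walk_sum \<phi> (c v) = int (y r) + (int (y v) - int (y r))] (mod int p)"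
        using walk_sum_coboundary[OF p c[OF v], of y] by (intro cong_add) (simp_all add: cob)
      then have "[int (Y (y r) v) = int (y v)] (mod int p)"
        using Y[OF v, of "y r"] by (simp add: cong_def)
      then show ?thesis using lt[OF v] by (simp add: cong_int_iff cong_def)
    qed
    then have "y = Y (y r)"
      using y Y_range[of "y r"] by (intro PiE_ext) auto
    then show "y \<in> Y ` {..<p}" using lt(1)[OF r] by blast
  next
    fix y assume "y \<in> Y ` {..<p}"
    then obtain k where k: "y = Y k" by blast
    have "coboundary p G (Y k) = \<phi>"
    proof (rule coboundary_eqI[OF p])
      show "\<phi> \<in> arcs G \<rightarrow>\<^sub>E {0..p-1}" using \<phi> by (simp add: dual_flow_def)
    next
      fix e assume e: "e \<in> arcs G"
      let ?t = "tail G e" and ?h = "head G e"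
      have th: "?t \<in> verts G" "?h \<in> verts G" using e by auto
      have "T.awalk ?t [(e, True)] ?h" using e by (simp add: T.awalk_simps)
      \<comment> \<open>Go out to the tail along \<open>c ?t\<close>, cross \<open>e\<close>, and
        return from the head against \<open>c ?h\<close>: the zero sum of this closed walk gives
        \<open>\<phi> e\<close> as the difference of the two walk sums.\<close>
      then have "T.awalk r (c ?t @ [(e, True)] @ reverse_walk (c ?h)) r"
        using c th awalk_reverse by (blast intro: T.awalk_appendI)
      from dual_flow_closed_walk[OF \<phi> this]
      have "[int (\<phi> e) - (walk_sum \<phi> (c ?h) - walk_sum \<phi> (c ?t)) = 0] (mod int p)"
        by (simp add: walk_sum_reverse algebra_simps)
      then have "[int (\<phi> e) = walk_sum \<phi> (c ?h) - walk_sum \<phi> (c ?t)] (mod int p)"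
        by (simp only: cong_diff_iff_cong_0)
      moreover have "[int (Y k ?h) - int (Y k ?t) =
          (int k + walk_sum \<phi> (c ?h)) - (int k + walk_sum \<phi> (c ?t))] (mod int p)"
        by (intro cong_diff Y th)
      ultimately show "[int (\<phi> e) = int (Y k ?h) - int (Y k ?t)] (mod int p)"
        by (simp add: cong_def)
    qed
    with Y_range k show "y \<in> {y \<in> verts G \<rightarrow>\<^sub>E {0..p-1}. coboundary p G y = \<phi>}" by simp
  qed
  moreover have "inj_on Y {..<p}" using Yr by (metis inj_onI lessThan_iff)
  ultimately show ?thesis by (simp add: card_image)
qed

section \<open>Normal forms modulo the root ideal\<close>

lemma polys_inI:
  "(\<And>m. m \<in> Poly_Mapping.keys f \<Longrightarrow> Poly_Mapping.keys m \<subseteq> E) \<Longrightarrow> f \<in> polys_in E"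
  by (auto simp: polys_in_def)

lemma polys_in_0 [simp]: "0 \<in> polys_in E"
  and polys_in_1 [simp]: "1 \<in> polys_in E"
  and polys_in_pconst [simp]: "pconst c \<in> polys_in E"
  by (simp_all add: polys_in_def pconst_def)

lemma polys_in_pvar: "e \<in> E \<Longrightarrow> pvar e \<in> polys_in E"
  by (simp add: polys_in_def pvar_def)

lemma polys_in_add: "f \<in> polys_in E \<Longrightarrow> g \<in> polys_in E \<Longrightarrow> f + g \<in> polys_in E"
  using keys_add[of f g] by (fastforce simp: polys_in_def)

lemma polys_in_mult:
  assumes "f \<in> polys_in E" and "g \<in> polys_in E"
  shows "f * g \<in> polys_in E"
proof (rule polys_inI)
  fix m assume "m \<in> Poly_Mapping.keys (f * g)"
  then obtain a b where "m = a + b" "a \<in> Poly_Mapping.keys f" "b \<in> Poly_Mapping.keys g"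
    using keys_mult[of f g] by blast
  then show "Poly_Mapping.keys m \<subseteq> E"
    using assms keys_add[of a b] by (fastforce simp: polys_in_def)
qed

lemma polys_in_uminus: "f \<in> polys_in E \<Longrightarrow> - f \<in> polys_in E"
  by (simp add: polys_in_def)

lemma polys_in_diff: "f \<in> polys_in E \<Longrightarrow> g \<in> polys_in E \<Longrightarrow> f - g \<in> polys_in E"
  using polys_in_add[of f E "- g"] polys_in_uminus[of g E] by simp

lemma polys_in_power: "f \<in> polys_in E \<Longrightarrow> f ^ n \<in> polys_in E"
  by (induction n) (auto intro: polys_in_mult)

lemma polys_in_sum: "(\<And>x. x \<in> A \<Longrightarrow> f x \<in> polys_in E) \<Longrightarrow> sum f A \<in> polys_in E"
  by (induction A rule: infinite_finite_induct) (auto intro: polys_in_add)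

lemma polys_in_prod: "(\<And>x. x \<in> A \<Longrightarrow> f x \<in> polys_in E) \<Longrightarrow> prod f A \<in> polys_in E"
  by (induction A rule: infinite_finite_induct) (auto intro: polys_in_mult)

lemma root_ideal_0: "0 \<in> root_ideal p E"
  unfolding root_ideal_def by (intro CollectI exI[of _ "\<lambda>_. 0"]) simp

lemma root_ideal_add:
  assumes "f \<in> root_ideal p E" and "g \<in> root_ideal p E"
  shows "f + g \<in> root_ideal p E"
proof -
  obtain q r where "f = (\<Sum>e\<in>E. q e * (\<Sum>i=0..p-1. pvar e ^ i))" "\<forall>e\<in>E. q e \<in> polys_in E"
    and "g = (\<Sum>e\<in>E. r e * (\<Sum>i=0..p-1. pvar e ^ i))" "\<forall>e\<in>E. r e \<in> polys_in E"
    using assms unfolding root_ideal_def by blast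
  then show ?thesis
    unfolding root_ideal_def
    by (intro CollectI exI[of _ "\<lambda>e. q e + r e"])
      (simp add: polys_in_add distrib_right sum.distrib)
qed

lemma root_ideal_mult:
  assumes "h \<in> polys_in E" and "f \<in> root_ideal p E"
  shows "h * f \<in> root_ideal p E"
proof -
  obtain q where "f = (\<Sum>e\<in>E. q e * (\<Sum>i=0..p-1. pvar e ^ i))" "\<forall>e\<in>E. q e \<in> polys_in E"
    using assms unfolding root_ideal_def by blast
  then show ?thesis
    using assms(1) unfolding root_ideal_def
    by (intro CollectI exI[of _ "\<lambda>e. h * q e"])
      (simp add: polys_in_mult sum_distrib_left mult.assoc)
qed

lemma root_ideal_uminus: "f \<in> root_ideal p E \<Longrightarrow> - f \<in> root_ideal p E"
  using root_ideal_mult[of "- 1" E f p] by (simp add: polys_in_uminus)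

lemma root_ideal_generator:
  assumes "finite E" and "e \<in> E"
  shows "(\<Sum>i=0..p-1. pvar e ^ i) \<in> root_ideal p E"
proof -
  have "(\<Sum>i=0..p-1. pvar e ^ i) =
      (\<Sum>d\<in>E. (if d = e then 1 else 0) * (\<Sum>i=0..p-1. pvar d ^ i))"
    using assms by (simp add: if_distrib[of "\<lambda>x. x * _"] cong: if_cong)
  then show ?thesis
    unfolding root_ideal_def by (intro CollectI exI[of _ "\<lambda>d. if d = e then 1 else 0"]) simp
qed

section \<open>Congruence modulo the ideal and reduction of powers\<close>

definition root_cong :: "nat \<Rightarrow> 'e set \<Rightarrow> 'e cpoly \<Rightarrow> 'e cpoly \<Rightarrow> bool" where
  "root_cong p E f g \<longleftrightarrow> f - g \<in> root_ideal p E"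

lemma root_cong_refl [simp]: "root_cong p E f f"
  by (simp add: root_cong_def root_ideal_0)

lemma root_cong_sym: "root_cong p E f g \<Longrightarrow> root_cong p E g f"
  unfolding root_cong_def using root_ideal_uminus by fastforce

lemma root_cong_trans [trans]:
  "root_cong p E f g \<Longrightarrow> root_cong p E g h \<Longrightarrow> root_cong p E f h"
  unfolding root_cong_def using root_ideal_add by fastforce

lemma root_cong_add:
  "root_cong p E f f' \<Longrightarrow> root_cong p E g g' \<Longrightarrow> root_cong p E (f + g) (f' + g')"
  unfolding root_cong_def using root_ideal_add by (fastforce simp: algebra_simps)

text \<open>The ideal absorbs factors from \<open>polys_in E\<close>; in the telescoped difference
  of the products these factors are \<open>f\<close> and \<open>g'\<close>.\<close>

lemma root_cong_mult:
  assumes "root_cong p E f f'" and "root_cong p E g g'" and "f \<in> polys_in E" and "g' \<in> polys_in E"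
  shows "root_cong p E (f * g) (f' * g')"
proof -
  have "f * g - f' * g' = f * (g - g') + g' * (f - f')"
    by (simp add: algebra_simps)
  with assms show ?thesis
    unfolding root_cong_def by (metis root_ideal_add root_ideal_mult)
qed

lemma root_cong_sum:
  "(\<And>x. x \<in> A \<Longrightarrow> root_cong p E (f x) (g x)) \<Longrightarrow> root_cong p E (sum f A) (sum g A)"
  by (induction A rule: infinite_finite_induct) (auto intro: root_cong_add)

lemma root_cong_prod:
  assumes "\<And>x. x \<in> A \<Longrightarrow> root_cong p E (f x) (g x)"
    and "\<And>x. x \<in> A \<Longrightarrow> f x \<in> polys_in E" and "\<And>x. x \<in> A \<Longrightarrow> g x \<in> polys_in E"
  shows "root_cong p E (prod f A) (prod g A)"
  using assms
  by (induction A rule: infinite_finite_induct) (auto intro!: root_cong_mult polys_in_prod)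

text \<open>Multiplying the generator \<open>1 + x + ... + x^(p-1)\<close> by \<open>x - 1\<close>
  gives \<open>x^p - 1\<close>.\<close>

lemma pvar_power_p_cong:
  assumes "finite E" and "e \<in> E" and "p > 0"
  shows "root_cong p E (pvar e ^ p) 1"
proof -
  have "pvar e ^ p - 1 = (pvar e - 1) * (\<Sum>i<p. pvar e ^ i)"
    by (rule power_diff_1_eq)
  also have "{..<p} = {0..p-1}" using assms(3) by auto
  finally have eq: "pvar e ^ p - 1 = (pvar e - 1) * (\<Sum>i=0..p-1. pvar e ^ i)" .
  show ?thesis
    unfolding root_cong_def eq
    using assms by (intro root_ideal_mult root_ideal_generator polys_in_diff polys_in_pvar polys_in_1)
qed

lemma pvar_power_mod_cong:
  assumes "finite E" and "e \<in> E" and "p > 0"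
  shows "root_cong p E (pvar e ^ n) (pvar e ^ (n mod p))"
proof -
  have "root_cong p E ((pvar e ^ p) ^ k) 1" for k
    using root_cong_prod[of "{..<k}" p E "\<lambda>_. pvar e ^ p" "\<lambda>_. 1"] assms
    by (simp add: pvar_power_p_cong polys_in_power polys_in_pvar)
  then have "root_cong p E ((pvar e ^ p) ^ (n div p) * pvar e ^ (n mod p)) (1 * pvar e ^ (n mod p))"
    using assms by (intro root_cong_mult) (auto simp: polys_in_power polys_in_pvar)
  moreover have "(pvar e ^ p) ^ (n div p) * pvar e ^ (n mod p) = pvar e ^ n"
    by (simp flip: power_mult power_add)
  ultimately show ?thesis by simp
qed

text \<open>
  The coefficient of \<open>x ^ i\<close> in the normal form of \<open>x ^ j\<close>, for \<open>j < p\<close> and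
  \<open>i < p - 1\<close>: it comes from \<open>x ^ (p - 1) \<equiv> - (1 + x + \<dots> + x ^ (p - 2))\<close>.
\<close>
definition reduction_coeff :: "nat \<Rightarrow> nat \<Rightarrow> nat \<Rightarrow> int" where
  "reduction_coeff p j i = (if j = p - 1 then - 1 else if j = i then 1 else 0)"

lemma pvar_power_reduction_cong:
  assumes "finite E" and "e \<in> E" and "p \<ge> 2" and "j < p"
  shows "root_cong p E (pvar e ^ j)
    (\<Sum>i=0..p-2. of_int (reduction_coeff p j i) * pvar e ^ i)"
proof (cases "j = p - 1")
  case True
  have p: "p - 1 = Suc (p - 2)" using assms(3) by simp
  \<comment> \<open>All coefficients are \<open>-1\<close>, so the difference is the generator
    itself.\<close>
  have eq: "pvar e ^ j - (\<Sum>i=0..p-2. of_int (reduction_coeff p j i) * pvar e ^ i) =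
      (\<Sum>i=0..p-1. pvar e ^ i)"
    unfolding p using True p by (simp add: reduction_coeff_def sum_negf)
  show ?thesis
    unfolding root_cong_def eq using assms(1,2) by (rule root_ideal_generator)
next
  case False
  with assms have "j \<in> {0..p-2}" by auto
  \<comment> \<open>Only the term \<open>i = j\<close> survives, so both sides are equal as
    polynomials.\<close>
  with False show ?thesis
    by (simp add: reduction_coeff_def if_distrib[of of_int] if_distrib[of "\<lambda>x. x * _"] cong: if_cong)
qed

section \<open>Coefficient functionals and uniqueness of the normal form\<close>

lemma prod_pvar_power:
  "finite E \<Longrightarrow> (\<Prod>e\<in>E. pvar e ^ n e) =
    Poly_Mapping.single (\<Sum>e\<in>E. Poly_Mapping.single e (n e)) 1"
proof (induction E rule: finite_induct)
  case (insert x F)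
  have "pvar x ^ k = Poly_Mapping.single (Poly_Mapping.single x k) 1" for k
    by (induction k) (simp_all add: pvar_def mult_single single_add[symmetric] add.commute)
  with insert show ?case by (simp add: mult_single)
qed simp

lemma lookup_sum_single:
  "finite E \<Longrightarrow> e \<in> E \<Longrightarrow> Poly_Mapping.lookup (\<Sum>e\<in>E. Poly_Mapping.single e (n e)) e = n e"
  by (simp add: lookup_sum lookup_single when_def)

text \<open>
  The coefficient of the basic monomial \<open>\<psi>\<close> in the normal form, as a linear functional
  on polynomials.
\<close>
definition nf_coeff :: "nat \<Rightarrow> 'e set \<Rightarrow> ('e \<Rightarrow> nat) \<Rightarrow> 'e cpoly \<Rightarrow> complex" where
  "nf_coeff p E \<psi> f = (\<Sum>m\<in>Poly_Mapping.keys f. Poly_Mapping.lookup f m *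
     (\<Prod>e\<in>E. of_int (reduction_coeff p (Poly_Mapping.lookup m e mod p) (\<psi> e))))"

lemma nf_coeff_add: "nf_coeff p E \<psi> (f + g) = nf_coeff p E \<psi> f + nf_coeff p E \<psi> g"
  unfolding nf_coeff_def by (rule setsum_keys_plus_distrib) (simp_all add: distrib_right)

lemma nf_coeff_sum: "nf_coeff p E \<psi> (sum f A) = (\<Sum>x\<in>A. nf_coeff p E \<psi> (f x))"
  by (induction A rule: infinite_finite_induct) (simp_all add: nf_coeff_add, simp_all add: nf_coeff_def)

lemma nf_coeff_single:
  "nf_coeff p E \<psi> (Poly_Mapping.single m c) =
    c * (\<Prod>e\<in>E. of_int (reduction_coeff p (Poly_Mapping.lookup m e mod p) (\<psi> e)))"
  by (simp add: nf_coeff_def)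

text \<open>The functionals are dual to the basic monomials: exponents up to \<open>p - 2\<close>
  are unchanged by \<open>mod p\<close> and never meet the exceptional case
  \<open>p - 1\<close>.\<close>

lemma nf_coeff_power_product:
  assumes "finite E" and "p \<ge> 2" and "\<psi> \<in> basic_exponents p E" and "\<psi>' \<in> basic_exponents p E"
  shows "nf_coeff p E \<psi> (pconst c * power_product E \<psi>') = (if \<psi> = \<psi>' then c else 0)"
proof -
  have le: "\<psi> e \<le> p - 2" "\<psi>' e \<le> p - 2" if "e \<in> E" for e
    using assms(3,4) that by (auto simp: basic_exponents_def dest: PiE_mem)
  have "(of_int (reduction_coeff p (\<psi>' e mod p) (\<psi> e)) :: complex) =
      (if \<psi> e = \<psi>' e then 1 else 0)" if "e \<in> E" for e
    using le[OF that] assms(2) by (auto simp: reduction_coeff_def)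
  then have "nf_coeff p E \<psi> (pconst c * power_product E \<psi>') =
      c * (\<Prod>e\<in>E. if \<psi> e = \<psi>' e then 1 else 0)"
    using assms(1)
    by (simp add: power_product_def prod_pvar_power pconst_def mult_single nf_coeff_single
        lookup_sum_single cong: prod.cong)
  also have "\<psi> = \<psi>' \<longleftrightarrow> (\<forall>e\<in>E. \<psi> e = \<psi>' e)"
    using assms(3,4) by (auto simp: basic_exponents_def intro: PiE_ext)
  then have "c * (\<Prod>e\<in>E. if \<psi> e = \<psi>' e then 1 else 0) = (if \<psi> = \<psi>' then c else 0)"
    using assms(1) by (auto simp: prod_zero_iff)
  finally show ?thesis .
qed

text \<open>The residues of \<open>n + k\<close> run through \<open>0, ..., p-1\<close> once each;
  the residue \<open>p - 1\<close> contributes \<open>-1\<close> and the residue \<open>i\<close>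
  contributes \<open>1\<close>. This is the one-variable reason why the functionals annihilate the
  ideal.\<close>

lemma sum_reduction_coeff:
  assumes "p \<ge> 2" and "i \<le> p - 2"
  shows "(\<Sum>k=0..p-1. reduction_coeff p ((n + k) mod p) i) = 0"
proof -
  have "(\<lambda>k. (n + k) mod p) ` {0..p-1} = {0..p-1}"
  proof (rule endo_inj_surj)
    show "inj_on (\<lambda>k. (n + k) mod p) {0..p-1}"
    proof (rule inj_onI)
      fix x y assume xy: "x \<in> {0..p-1}" "y \<in> {0..p-1}" "(n + x) mod p = (n + y) mod p"
      then have "[x = y] (mod p)" by (simp add: cong_def[symmetric] cong_add_lcancel_nat)
      then show "x = y" using xy assms(1) by (simp add: cong_def)
    qed
  next
    have "k mod p \<le> p - 1" for k using assms(1) mod_less_divisor[of p k] by linarith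
    then show "(\<lambda>k. (n + k) mod p) ` {0..p-1} \<subseteq> {0..p-1}" by auto
  qed simp
  moreover from this have "inj_on (\<lambda>k. (n + k) mod p) {0..p-1}"
    by (simp add: eq_card_imp_inj_on)
  ultimately have "(\<Sum>k=0..p-1. reduction_coeff p ((n + k) mod p) i) =
      (\<Sum>j=0..p-1. reduction_coeff p j i)"
    using sum.reindex[of "\<lambda>k. (n + k) mod p" "{0..p-1}" "\<lambda>j. reduction_coeff p j i"] by (simp add: o_def)
  also have "(\<Sum>j=0..p-1. reduction_coeff p j i) = - 1 + (\<Sum>j=0..p-2. reduction_coeff p j i)"
  proof -
    have "{0..p-1} = insert (p - 1) {0..p-2}" using assms(1) by auto
    then show ?thesis using assms(1) by (simp add: reduction_coeff_def)
  qed
  also have "(\<Sum>j=0..p-2. reduction_coeff p j i) = (\<Sum>j=0..p-2. if j = i then 1 else 0)"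
    using assms by (intro sum.cong) (auto simp: reduction_coeff_def)
  also have "\<dots> = 1" using assms(2) by simp
  finally show ?thesis by simp
qed

text \<open>By linearity it is enough to treat a monomial times one generator. There only the
  exponent of \<open>e\<close> varies, so the other arcs give a common factor \<open>?C\<close> and
  \<open>sum_reduction_coeff\<close> applies.\<close>

lemma nf_coeff_root_ideal:
  assumes "finite E" and "p \<ge> 2" and "\<psi> \<in> basic_exponents p E" and "f \<in> root_ideal p E"
  shows "nf_coeff p E \<psi> f = 0"
proof -
  have mono: "nf_coeff p E \<psi> (Poly_Mapping.single m c * (\<Sum>i=0..p-1. pvar e ^ i)) = 0"
    if e: "e \<in> E" for m c e
  proof -
    let ?w = "\<lambda>d k. of_int (reduction_coeff p (k mod p) (\<psi> d)) :: complex"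
    let ?C = "\<Prod>d\<in>E - {e}. ?w d (Poly_Mapping.lookup m d)"
    have "nf_coeff p E \<psi> (Poly_Mapping.single m c * pvar e ^ i) =
        c * ?C * ?w e (Poly_Mapping.lookup m e + i)" for i
    proof -
      have "pvar e ^ i = Poly_Mapping.single (Poly_Mapping.single e i) 1"
        using prod_pvar_power[of "{e}" "\<lambda>_. i"] by simp
      then have "nf_coeff p E \<psi> (Poly_Mapping.single m c * pvar e ^ i) =
          c * (\<Prod>d\<in>E. ?w d (Poly_Mapping.lookup (m + Poly_Mapping.single e i) d))"
        by (simp add: mult_single nf_coeff_single)
      also have "\<dots> = c * (?w e (Poly_Mapping.lookup m e + i) *
          (\<Prod>d\<in>E - {e}. ?w d (Poly_Mapping.lookup (m + Poly_Mapping.single e i) d)))"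
        using assms(1) e by (simp add: prod.remove lookup_add)
      also have "(\<Prod>d\<in>E - {e}. ?w d (Poly_Mapping.lookup (m + Poly_Mapping.single e i) d)) = ?C"
        by (intro prod.cong) (auto simp: lookup_add lookup_single)
      finally show ?thesis by simp
    qed
    then have "nf_coeff p E \<psi> (Poly_Mapping.single m c * (\<Sum>i=0..p-1. pvar e ^ i)) =
        c * ?C * of_int (\<Sum>i=0..p-1. reduction_coeff p ((Poly_Mapping.lookup m e + i) mod p) (\<psi> e))"
      by (simp add: sum_distrib_left nf_coeff_sum)
    moreover have "\<psi> e \<le> p - 2"
      using assms(3) e by (auto simp: basic_exponents_def dest: PiE_mem)
    ultimately show ?thesis using assms(2) by (simp only: sum_reduction_coeff) simp
  qed
  have "nf_coeff p E \<psi> (q * (\<Sum>i=0..p-1. pvar e ^ i)) = 0" if "e \<in> E" for q e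
  proof -
    have "q = (\<Sum>m\<in>Poly_Mapping.keys q. Poly_Mapping.single m (Poly_Mapping.lookup q m))"
      by (rule poly_mapping_eqI) (simp add: lookup_sum lookup_single when_def in_keys_iff)
    from arg_cong[OF this, of "\<lambda>q. nf_coeff p E \<psi> (q * (\<Sum>i=0..p-1. pvar e ^ i))"]
    have "nf_coeff p E \<psi> (q * (\<Sum>i=0..p-1. pvar e ^ i)) =
        (\<Sum>m\<in>Poly_Mapping.keys q. nf_coeff p E \<psi>
          (Poly_Mapping.single m (Poly_Mapping.lookup q m) * (\<Sum>i=0..p-1. pvar e ^ i)))"
      by (simp only: sum_distrib_right nf_coeff_sum)
    with mono[OF that] show ?thesis by simp
  qed
  with assms(4) show ?thesis
    by (auto simp: root_ideal_def nf_coeff_sum)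
qed

text \<open>Uniqueness is what \<open>THE\<close> requires: two candidates differ by an element of
  the ideal, so the functionals \<open>nf_coeff\<close> read the same coefficients from
  both.\<close>

lemma normal_form_eqI:
  assumes "finite E" and "p \<ge> 2" and "g \<in> basic_combinations p E" and "root_cong p E f g"
  shows "normal_form p E f = g"
  unfolding normal_form_def
proof (rule the_equality)
  show "g \<in> basic_combinations p E \<and> f - g \<in> root_ideal p E"
    using assms(3,4) by (simp add: root_cong_def)
next
  fix h assume h: "h \<in> basic_combinations p E \<and> f - h \<in> root_ideal p E"
  from assms(3) obtain a where
    a: "g = (\<Sum>\<psi>\<in>basic_exponents p E. pconst (a \<psi>) * power_product E \<psi>)"
    unfolding basic_combinations_def by blast
  from h obtain b where
    b: "h = (\<Sum>\<psi>\<in>basic_exponents p E. pconst (b \<psi>) * power_product E \<psi>)"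
    unfolding basic_combinations_def by blast
  have fin: "finite (basic_exponents p E)"
    using assms(1) by (simp add: basic_exponents_def finite_PiE)
  have ideal: "h - g \<in> root_ideal p E"
    using root_cong_trans[OF root_cong_sym assms(4), of h] h by (simp add: root_cong_def)
  have "b \<psi> = a \<psi>" if \<psi>: "\<psi> \<in> basic_exponents p E" for \<psi>
  proof -
    have coeff: "nf_coeff p E \<psi> (\<Sum>\<psi>\<in>basic_exponents p E. pconst (k \<psi>) * power_product E \<psi>) = k \<psi>" for k
      using fin \<psi> assms(1,2) by (simp add: nf_coeff_sum nf_coeff_power_product)
    have "nf_coeff p E \<psi> h = nf_coeff p E \<psi> (h - g) + nf_coeff p E \<psi> g"
      by (simp flip: nf_coeff_add)
    then show ?thesis
      using nf_coeff_root_ideal[OF assms(1,2) \<psi> ideal] coeff[of a] coeff[of b] by (simp flip: a b)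
  qed
  then show "h = g" by (simp add: a b)
qed

text \<open>An arc with \<open>\<phi> e\<close> outside \<open>{\<psi> e, p - 1}\<close> contributes
  a factor \<open>0\<close>, an arc with value \<open>p - 1\<close> a sign, and any other arc
  \<open>1\<close>.\<close>

lemma prod_reduction_coeff:
  assumes "finite E"
  shows "(\<Prod>e\<in>E. reduction_coeff p (\<phi> e) (\<psi> e)) =
    (if conformal p E \<psi> \<phi> then if even_map p E \<phi> then 1 else - 1 else 0)"
proof (cases "conformal p E \<psi> \<phi>")
  case True
  then have "(\<Prod>e\<in>E. reduction_coeff p (\<phi> e) (\<psi> e)) = (\<Prod>e\<in>E. if \<phi> e = p - 1 then - 1 else 1)"
    by (intro prod.cong) (auto simp: conformal_def reduction_coeff_def)
  also have "\<dots> = (- 1) ^ card {e \<in> E. \<phi> e = p - 1}"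
    using assms by (simp add: prod.If_cases Int_def)
  finally show ?thesis using True by (simp add: even_map_def)
next
  case False
  then show ?thesis
    using assms by (auto simp: conformal_def reduction_coeff_def prod_zero_iff)
qed

section \<open>The normal form of the flow polynomial\<close>

text \<open>Here \<open>y v\<close> is the summation index picked at \<open>v\<close> when the
  product is expanded. Every arc is an in-arc of exactly its head and an out-arc of exactly its
  tail, so it collects both exponents; a loop gets them from the same vertex.\<close>

lemma (in fin_digraph) flow_poly_expand:
  "flow_poly p G = (\<Sum>y\<in>verts G \<rightarrow>\<^sub>E {0..p-1}.
     \<Prod>e\<in>arcs G. pvar e ^ (y (head G e) + (p - 1) * y (tail G e)))"
proof -
  have "(\<Prod>v\<in>verts G. ((\<Prod>e\<in>in_arcs G v. pvar e) * (\<Prod>e\<in>out_arcs G v. pvar e ^ (p - 1))) ^ y v) =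
      (\<Prod>e\<in>arcs G. pvar e ^ (y (head G e) + (p - 1) * y (tail G e)))" for y :: "_ \<Rightarrow> nat"
  proof -
    have "(\<Prod>v\<in>verts G. (\<Prod>e\<in>in_arcs G v. pvar e) ^ y v) =
        (\<Prod>v\<in>verts G. \<Prod>e\<in>{e \<in> arcs G. head G e = v}. pvar e ^ y (head G e))"
      by (simp add: in_arcs_def prod_power_distrib)
    also have "\<dots> = (\<Prod>e\<in>arcs G. pvar e ^ y (head G e))"
      by (rule prod.group) auto
    finally have heads: "(\<Prod>v\<in>verts G. (\<Prod>e\<in>in_arcs G v. pvar e) ^ y v) = \<dots>" .
    have "(\<Prod>v\<in>verts G. (\<Prod>e\<in>out_arcs G v. pvar e ^ (p - 1)) ^ y v) =
        (\<Prod>v\<in>verts G. \<Prod>e\<in>{e \<in> arcs G. tail G e = v}. pvar e ^ ((p - 1) * y (tail G e)))"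
      by (simp add: out_arcs_def prod_power_distrib power_mult)
    also have "\<dots> = (\<Prod>e\<in>arcs G. pvar e ^ ((p - 1) * y (tail G e)))"
      by (rule prod.group) auto
    finally have tails: "(\<Prod>v\<in>verts G. (\<Prod>e\<in>out_arcs G v. pvar e ^ (p - 1)) ^ y v) = \<dots>" .
    show ?thesis
      by (simp only: power_mult_distrib prod.distrib heads tails power_add)
  qed
  then show ?thesis
    unfolding flow_poly_def by (subst prod_sum_PiE) simp_all
qed

lemma finite_dual_flows: "finite (arcs G) \<Longrightarrow> finite {\<phi>. dual_flow p G \<phi>}"
  by (rule finite_subset[of _ "arcs G \<rightarrow>\<^sub>E {0..p-1}"]) (auto simp: dual_flow_def finite_PiE)

text \<open>After the exponents are reduced, the potentials are grouped by their coboundary; the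
  fibre size is the factor \<open>p\<close> of the theorem.\<close>

lemma (in fin_digraph) flow_poly_cong_dual_flows:
  assumes "Digraph_Component.connected G" and "p > 0"
  shows "root_cong p (arcs G) (flow_poly p G)
    (of_nat p * (\<Sum>\<phi> | dual_flow p G \<phi>. power_product (arcs G) \<phi>))"
proof -
  let ?Y = "verts G \<rightarrow>\<^sub>E {0..p-1}"
  have "root_cong p (arcs G) (flow_poly p G) (\<Sum>y\<in>?Y. power_product (arcs G) (coboundary p G y))"
    unfolding flow_poly_expand power_product_def
  proof (intro root_cong_sum root_cong_prod)
    fix y e assume "e \<in> arcs G"
    then show "root_cong p (arcs G) (pvar e ^ (y (head G e) + (p - 1) * y (tail G e)))
        (pvar e ^ coboundary p G y e)"
      using pvar_power_mod_cong[of "arcs G" e p] assms(2) by (simp add: coboundary_def)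
  qed (auto intro: polys_in_power polys_in_pvar)
  also have "(\<Sum>y\<in>?Y. power_product (arcs G) (coboundary p G y)) =
      (\<Sum>\<phi> | dual_flow p G \<phi>. \<Sum>y\<in>{y \<in> ?Y. coboundary p G y = \<phi>}.
        power_product (arcs G) (coboundary p G y))"
    using dual_flow_coboundary[OF assms(2)]
    by (intro sum.group[symmetric]) (auto simp: finite_PiE finite_dual_flows)
  also have "\<dots> = (\<Sum>\<phi> | dual_flow p G \<phi>. of_nat p * power_product (arcs G) \<phi>)"
    using card_coboundary_fiber[OF assms] by (intro sum.cong) simp_all
  finally show ?thesis by (simp add: sum_distrib_left)
qed

text \<open>Each variable is reduced on its own; expanding the product of the resulting sums picks
  one exponent per arc, that is, a \<open>\<psi>\<close>.\<close>

lemma power_product_cong: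
  assumes "finite E" and "p \<ge> 2" and "\<phi> \<in> E \<rightarrow>\<^sub>E {0..p-1}"
  shows "root_cong p E (power_product E \<phi>) (\<Sum>\<psi>\<in>basic_exponents p E.
    of_int (\<Prod>e\<in>E. reduction_coeff p (\<phi> e) (\<psi> e)) * power_product E \<psi>)"
proof -
  have lt: "\<phi> e < p" if "e \<in> E" for e
    using PiE_mem[OF assms(3) that] assms(2) by auto
  have of_int: "of_int c \<in> polys_in E" for c
    using polys_in_pconst[of "of_int c" E] by (simp add: pconst_def)
  have "root_cong p E (power_product E \<phi>)
      (\<Prod>e\<in>E. \<Sum>i=0..p-2. of_int (reduction_coeff p (\<phi> e) i) * pvar e ^ i)"
    unfolding power_product_def
    using assms(1,2) lt
    by (intro root_cong_prod pvar_power_reduction_cong polys_in_sum polys_in_mult polys_in_power polys_in_pvar of_int)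
  also have "(\<Prod>e\<in>E. \<Sum>i=0..p-2. of_int (reduction_coeff p (\<phi> e) i) * pvar e ^ i) =
      (\<Sum>\<psi>\<in>basic_exponents p E. \<Prod>e\<in>E. of_int (reduction_coeff p (\<phi> e) (\<psi> e)) * pvar e ^ \<psi> e)"
    unfolding basic_exponents_def using assms(1) by (subst prod_sum_PiE) simp_all
  finally show ?thesis by (simp add: prod.distrib power_product_def)
qed

lemma sum_prod_reduction_coeff_dual_flows:
  assumes "finite (arcs G)"
  shows "(\<Sum>\<phi> | dual_flow p G \<phi>. \<Prod>e\<in>arcs G. reduction_coeff p (\<phi> e) (\<psi> e)) =
    conformal_excess p G \<psi>"
proof -
  let ?D = "{\<phi>. dual_flow p G \<phi>}" and ?E = "arcs G"
  \<comment> \<open>The sign of a conformal flow is written as a difference of two indicators, whose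
    sums are the two cardinalities in \<open>conformal_excess\<close>.\<close>
  have "(\<Sum>\<phi>\<in>?D. \<Prod>e\<in>?E. reduction_coeff p (\<phi> e) (\<psi> e)) =
      (\<Sum>\<phi>\<in>?D. (if conformal p ?E \<psi> \<phi> \<and> even_map p ?E \<phi> then 1 else 0) -
        (if conformal p ?E \<psi> \<phi> \<and> \<not> even_map p ?E \<phi> then 1 else 0))"
    by (intro sum.cong) (auto simp: prod_reduction_coeff[OF assms])
  then show ?thesis
    using finite_dual_flows[OF assms, of p]
    by (simp add: sum_subtractf sum.If_cases conformal_excess_def Int_def)
qed

theorem theorem3p3:
  fixes G :: "('v, 'e) pre_digraph" and p :: nat
  assumes "fin_digraph G"
    and "Digraph_Component.connected G"
    and "p \<ge> 2"
  shows "normal_form p (arcs G) (flow_poly p G) =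
    of_nat p * (\<Sum>\<psi>\<in>basic_exponents p (arcs G).
      of_int (conformal_excess p G \<psi>) * power_product (arcs G) \<psi>)"
proof -
  interpret fin_digraph G by fact
  let ?E = "arcs G" and ?B = "basic_exponents p (arcs G)"
  let ?rhs = "of_nat p * (\<Sum>\<psi>\<in>?B. of_int (conformal_excess p G \<psi>) * power_product ?E \<psi>)"
  have "root_cong p ?E (flow_poly p G) (of_nat p * (\<Sum>\<phi> | dual_flow p G \<phi>. power_product ?E \<phi>))"
    using assms by (intro flow_poly_cong_dual_flows) auto
  also have "root_cong p ?E \<dots> (of_nat p * (\<Sum>\<phi> | dual_flow p G \<phi>. \<Sum>\<psi>\<in>?B.
      of_int (\<Prod>e\<in>?E. reduction_coeff p (\<phi> e) (\<psi> e)) * power_product ?E \<psi>))"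
    \<comment> \<open>Moving \<open>of_nat p\<close> under the sum lets the congruence be shown flow
      by flow.\<close>
    unfolding sum_distrib_left[of "of_nat p" _ "{\<phi>. dual_flow p G \<phi>}"]
  proof (intro root_cong_sum root_cong_mult root_cong_refl)
    have "of_int c \<in> polys_in ?E" for c
      using polys_in_pconst[of "of_int c" ?E] by (simp add: pconst_def)
    then show "(\<Sum>\<psi>\<in>?B. of_int (\<Prod>e\<in>?E. reduction_coeff p (\<phi> e) (\<psi> e)) * power_product ?E \<psi>) \<in> polys_in ?E" for \<phi>
      unfolding power_product_def
      by (intro polys_in_sum polys_in_mult polys_in_prod polys_in_power polys_in_pvar)
    show "of_nat p \<in> polys_in ?E"
      using polys_in_pconst[of "of_nat p" ?E] by (simp add: pconst_def)
  next
    fix \<phi> assume "\<phi> \<in> {\<phi>. dual_flow p G \<phi>}"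
    then have "\<phi> \<in> ?E \<rightarrow>\<^sub>E {0..p-1}" by (simp add: dual_flow_def)
    then show "root_cong p ?E (power_product ?E \<phi>) (\<Sum>\<psi>\<in>?B.
        of_int (\<Prod>e\<in>?E. reduction_coeff p (\<phi> e) (\<psi> e)) * power_product ?E \<psi>)"
      using assms(3) by (intro power_product_cong) auto
  qed
  \<comment> \<open>Exchanging the sums collects, for each \<open>\<psi>\<close>, the signed count
    of its conformal dual flows.\<close>
  also have "(\<Sum>\<phi> | dual_flow p G \<phi>. \<Sum>\<psi>\<in>?B.
      of_int (\<Prod>e\<in>?E. reduction_coeff p (\<phi> e) (\<psi> e)) * power_product ?E \<psi>) =
      (\<Sum>\<psi>\<in>?B. of_int (conformal_excess p G \<psi>) * power_product ?E \<psi>)"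
    by (subst sum.swap, intro sum.cong refl)
      (simp add: sum_distrib_right flip: sum_prod_reduction_coeff_dual_flows)
  finally have cong: "root_cong p ?E (flow_poly p G) ?rhs" .
  \<comment> \<open>Membership in \<open>basic_combinations\<close> asks for coefficients of the
    form \<open>pconst\<close>, so \<open>p\<close> and the excess are merged into one complex
    constant.\<close>
  have "(pconst (of_nat p * of_int c) :: 'e cpoly) = of_nat p * of_int c" for c
    unfolding pconst_def using mult_single[of 0 "of_nat p :: complex" 0 "of_int c", symmetric]
    by simp
  then have "?rhs = (\<Sum>\<psi>\<in>?B. pconst (of_nat p * of_int (conformal_excess p G \<psi>)) * power_product ?E \<psi>)"
    by (simp add: sum_distrib_left mult.assoc)
  then have "?rhs \<in> basic_combinations p ?E"
    unfolding basic_combinations_def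
    by (intro CollectI exI[of _ "\<lambda>\<psi>. of_nat p * of_int (conformal_excess p G \<psi>)"]) simp
  from normal_form_eqI[OF _ assms(3) this cong] show ?thesis by simp
qed

end
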